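(* Let $q\in\mathbb{C}$ with $0<|q|<1$ and let $b\in\mathbb{C}\setminus\{0\}$ with $b\notin\{q^k:k\in\mathbb{Z}\}$. Then \[ \frac{(q;q)^2_\infty}{[1/b;q]_\infty}\sum_{k=-\infty}^\infty\frac{(-b)^kq^{\frac{k(k+1)}{2}}}{1-bq^k}= - \sum_{n=0}^\infty \left(\frac{q^nb}{(1-bq^n)^2}+\frac{q^{n+1}/b}{(1-q^{n+1}/b)^2}\right)+ \sum_{\substack{n=-\infty \\ n \neq 0}}^{\infty} \frac{(-1)^nnq^{n(n+1)/2}}{1-q^n}. \]
   Context: For $|q|<1$: $(a;q)_\infty=\prod_{k\ge 0}(1-aq^k)$ and $[a;q]_\infty=(a;q)_\infty(q/a;q)_\infty$. *)

theory Defs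
  imports "HOL-Analysis.Analysis"
begin

definition qpoch_inf :: "complex \<Rightarrow> complex \<Rightarrow> complex" where
  "qpoch_inf a q = (\<Prod>k. 1 - a * q ^ k)"

text \<open>The modified theta product \<open>[a;q]\<^sub>\<infinity>\<close>, meaningful for \<open>a \<noteq> 0\<close>.\<close>

definition qtheta :: "complex \<Rightarrow> complex \<Rightarrow> complex" where
  "qtheta a q = qpoch_inf a q * qpoch_inf (q / a) q"

end

theory Submission
  imports Defs "HOL-Complex_Analysis.Complex_Analysis"
begin

text \<open>
  Both sides of the identity are invariant under \<open>b \<mapsto> q b\<close>, so the left-hand side plus the sum of
  double poles is constant once its singularity at \<open>b = 1\<close> is seen to be removable: on an annulus
  meeting every orbit its modulus attains a maximum. To find the value at \<open>b = 1\<close>, write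
  \<open>[z; q] = (1 - z) (q; q)\<^sup>2 H(w)\<close> with \<open>w = (1 - z)\<^sup>2 / z\<close>; the same maximum argument gives
  \<open>\<Sum>k. (-1)^k q^(k(k+1)/2) / (1 - z q^k) = 1 / ((1 - z) H(w))\<close>. The Appell sum differs from this
  by a series \<open>C(z)\<close> vanishing at 1, whose derivative there is the second sum on the right. The
  expansion \<open>H(w) = 1 - w \<Sum>n. q^n / (1 - q^n)\<^sup>2 + \<dots>\<close> cancels the remaining constants.
\<close>

section \<open>Series of holomorphic functions and sums over the nonzero integers\<close>

text \<open>A uniform summable majorant gives locally uniform convergence, hence termwise
  differentiation. The third claim is what later computes a derivative at 1.\<close>

lemma holomorphic_series_M_test:
  fixes f :: "nat \<Rightarrow> complex \<Rightarrow> complex"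
  assumes "open S" "\<And>n. f n holomorphic_on S" "summable M"
    and "\<forall>\<^sub>F n in sequentially. \<forall>x\<in>S. norm (f n x) \<le> M n"
  shows "(\<lambda>x. \<Sum>n. f n x) holomorphic_on S"
    and "x \<in> S \<Longrightarrow> summable (\<lambda>n. f n x)"
    and "x \<in> S \<Longrightarrow> (\<lambda>n. deriv (f n) x) sums deriv (\<lambda>x. \<Sum>n. f n x) x"
proof -
  obtain g g' where g: "\<forall>x\<in>S. (\<lambda>n. f n x) sums g x \<and> (\<lambda>n. deriv (f n) x) sums g' x \<and>
      (g has_field_derivative g' x) (at x)"
    by (rule series_and_derivative_comparison[OF assms(1,3) holomorphic_derivI[OF assms(2,1)] assms(4)])
  have der: "((\<lambda>x. \<Sum>n. f n x) has_field_derivative g' x) (at x)" if "x \<in> S" for x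
  proof (rule has_field_derivative_transform_within_open)
    show "(g has_field_derivative g' x) (at x)"
      using g that by blast
    show "g y = (\<Sum>n. f n y)" if "y \<in> S" for y
      using g that sums_unique by blast
  qed (use assms that in auto)
  then show "(\<lambda>x. \<Sum>n. f n x) holomorphic_on S"
    using assms(1) holomorphic_on_open by blast
  show "x \<in> S \<Longrightarrow> summable (\<lambda>n. f n x)"
    using g sums_summable by blast
  show "x \<in> S \<Longrightarrow> (\<lambda>n. deriv (f n) x) sums deriv (\<lambda>x. \<Sum>n. f n x) x"
    using g DERIV_imp_deriv[OF der] by simp
qed

text \<open>Both halves converge absolutely, so pairing \<open>n\<close> with \<open>-n\<close>
  gives the unconditional sum. This links \<open>infsum\<close> over integers to series over
  \<open>nat\<close>, where the M-test applies.\<close>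

lemma has_sum_int_nonzero:
  fixes h :: "int \<Rightarrow> 'a :: banach"
  assumes "summable M"
    and "\<forall>\<^sub>F n in sequentially. norm (h (int n)) \<le> M n"
    and "\<forall>\<^sub>F n in sequentially. norm (h (- int n)) \<le> M n"
  shows "(h has_sum (\<Sum>n. h (int (Suc n)) + h (- int (Suc n)))) (UNIV - {0})"
proof -
  have "summable (\<lambda>n. norm (h (int n)))" "summable (\<lambda>n. norm (h (- int n)))"
    using assms by (auto intro!: summable_comparison_test_ev[OF _ assms(1)])
  then have s: "summable (\<lambda>n. norm (h (int (Suc n))))" "summable (\<lambda>n. norm (h (- int (Suc n))))"
    using summable_Suc_iff[of "\<lambda>n. norm (h (int n))"] summable_Suc_iff[of "\<lambda>n. norm (h (- int n))"]
    by blast+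
  note s' = s[THEN summable_norm_cancel]
  have "(h has_sum (\<Sum>n. h (int (Suc n)))) (range (\<lambda>n. int (Suc n)))"
    using norm_summable_imp_has_sum[OF s(1) summable_sums[OF s'(1)]]
    by (subst has_sum_reindex) (auto simp: inj_on_def o_def)
  moreover have "(h has_sum (\<Sum>n. h (- int (Suc n)))) (range (\<lambda>n. - int (Suc n)))"
    using norm_summable_imp_has_sum[OF s(2) summable_sums[OF s'(2)]]
    by (subst has_sum_reindex) (auto simp: inj_on_def o_def)
  ultimately have "(h has_sum ((\<Sum>n. h (int (Suc n))) + (\<Sum>n. h (- int (Suc n)))))
      (range (\<lambda>n. int (Suc n)) \<union> range (\<lambda>n. - int (Suc n)))"
    by (rule has_sum_Un_disjoint) auto
  moreover have "range (\<lambda>n. int (Suc n)) \<union> range (\<lambda>n. - int (Suc n)) = UNIV - {0}"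
  proof (intro equalityI subsetI)
    fix k :: int assume "k \<in> UNIV - {0}"
    then show "k \<in> range (\<lambda>n. int (Suc n)) \<union> range (\<lambda>n. - int (Suc n))"
      by (cases k rule: int_cases3) (auto simp: image_iff gr0_conv_Suc)
  qed auto
  ultimately show ?thesis
    using suminf_add[OF s'] by simp
qed

lemma infsum_int_split_zero:
  fixes h :: "int \<Rightarrow> complex"
  assumes "(h has_sum s) (UNIV - {0})"
  shows "h summable_on UNIV" "infsum h UNIV = h 0 + s"
proof -
  have "(h has_sum (h 0 + s)) ({0} \<union> (UNIV - {0}))"
    using assms by (intro has_sum_Un_disjoint) (auto intro: has_sum_finiteI)
  then show "h summable_on UNIV" "infsum h UNIV = h 0 + s"
    by (auto simp: infsumI summable_on_def)
qed

section \<open>Infinite products of linear factors as entire functions\<close>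

context
  fixes c :: "nat \<Rightarrow> complex"
  assumes summable_c: "summable (\<lambda>n. norm (c n))"
begin

lemma convergent_prod_linear: "convergent_prod (\<lambda>n. 1 - c n * w)"
proof -
  have "summable (\<lambda>n. norm (c n * w))"
    using summable_mult2[OF summable_c, of "norm w"] by (simp add: norm_mult)
  then show ?thesis
    by (intro abs_convergent_prod_imp_convergent_prod summable_imp_abs_convergent_prod) simp
qed

text \<open>On the disc of radius \<open>r\<close> the deviations of the factors from 1 are
  dominated by the summable \<open>norm (c n) * r\<close>.\<close>

lemma uniform_limit_prod_linear:
  "uniform_limit (cball 0 r) (\<lambda>n w. \<Prod>k<n. 1 - c k * w) (\<lambda>w. \<Prod>k. 1 - c k * w) sequentially"
proof -
  have "uniformly_convergent_on (cball 0 r) (\<lambda>n w. \<Prod>k<n. 1 - c k * w)"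
  proof (rule Complex_Transcendental.uniformly_convergent_on_prod')
    show "uniformly_convergent_on (cball 0 r) (\<lambda>n w. \<Sum>k<n. norm (1 - c k * w - 1))"
    proof (rule Weierstrass_m_test'_ev)
      show "\<forall>\<^sub>F n in sequentially. \<forall>w\<in>cball 0 r. norm (norm (1 - c n * w - 1)) \<le> norm (c n) * r"
        by (intro always_eventually) (auto simp: norm_mult mult_left_mono)
    qed (use summable_mult2[OF summable_c] in blast)
  qed (auto intro!: continuous_intros)
  then obtain l where l: "uniform_limit (cball 0 r) (\<lambda>n w. \<Prod>k<n. 1 - c k * w) l sequentially"
    by (auto simp: uniformly_convergent_on_def)
  \<comment> \<open>\<open>convergent_prod_LIMSEQ\<close> uses partial products over
    \<open>{..n}\<close>, whereas those here run over \<open>{..<n}\<close>.\<close>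
  have "l w = (\<Prod>k. 1 - c k * w)" if "w \<in> cball 0 r" for w
    using convergent_prod_LIMSEQ[OF convergent_prod_linear[of w]] tendsto_uniform_limitI[OF l that]
    by (metis LIMSEQ_lessThan_iff_atMost LIMSEQ_unique)
  then show ?thesis
    using l uniform_limit_cong'[OF refl, of "cball 0 r" l "\<lambda>w. \<Prod>k. 1 - c k * w"] by metis
qed

lemma holomorphic_prod_linear: "(\<lambda>w. \<Prod>k. 1 - c k * w) holomorphic_on A"
proof -
  have "(\<lambda>w. \<Prod>k. 1 - c k * w) holomorphic_on UNIV"
  proof (rule holomorphic_uniform_sequence)
    fix x :: complex
    have "cball x 1 \<subseteq> cball 0 (norm x + 1)"
      by (rule cball_subset_cball_iff[THEN iffD2]) simp
    then show "\<exists>d>0. cball x d \<subseteq> UNIV \<and>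
        uniform_limit (cball x d) (\<lambda>n w. \<Prod>k<n. 1 - c k * w) (\<lambda>w. \<Prod>k. 1 - c k * w) sequentially"
      using uniform_limit_on_subset[OF uniform_limit_prod_linear] by (intro exI[of _ 1]) auto
  qed (auto intro!: holomorphic_intros)
  then show ?thesis
    by (rule holomorphic_on_subset) simp
qed

text \<open>At 0 every factor is 1, so the logarithmic derivative is the derivative, and it is the
  sum of the derivatives \<open>- c k\<close> of the factors.\<close>

lemma prod_linear_has_derivative_0:
  "((\<lambda>w. \<Prod>k. 1 - c k * w) has_field_derivative - suminf c) (at 0)"
proof -
  have d: "deriv (\<lambda>w. 1 - c k * w) 0 = - c k" for k
    by (rule DERIV_imp_deriv) (auto intro!: derivative_eq_intros)
  have "(\<lambda>k. deriv (\<lambda>w. 1 - c k * w) 0 / (1 - c k * 0)) sums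
      (deriv (\<lambda>w. \<Prod>k. 1 - c k * w) 0 / (\<Prod>k. 1 - c k * 0))"
    by (rule logderiv_prodinf_complex_uniform_limit[where A = "ball 0 1"])
       (auto intro!: holomorphic_intros uniform_limit_on_subset[OF uniform_limit_prod_linear[of 1]])
  then have "(\<lambda>k. - c k) sums deriv (\<lambda>w. \<Prod>k. 1 - c k * w) 0"
    by (simp add: d)
  then have "deriv (\<lambda>w. \<Prod>k. 1 - c k * w) 0 = - suminf c"
    using suminf_minus[OF summable_norm_cancel[OF summable_c]] by (simp add: sums_iff)
  then show ?thesis
    using holomorphic_derivI[OF holomorphic_prod_linear[of UNIV] open_UNIV, of 0] by simp
qed

end

section \<open>The fundamental annulus and rigidity of \<open>q\<close>-periodic functions\<close>

locale nome =
  fixes q :: complex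
  assumes q0: "0 < norm q" and q1: "norm q < 1"
begin

text \<open>The largest annulus around the unit circle that contains no integer power of
  \<open>q\<close> except 1. It is symmetric under inversion, and among the terms of the bilateral
  series only \<open>k = 0\<close> is singular in it.\<close>

definition annulus :: "complex set" where
  "annulus = {z. norm q < norm z \<and> norm z < 1 / norm q}"

lemma open_annulus: "open annulus"
  unfolding annulus_def by (intro open_Collect_conj open_Collect_less continuous_intros)

lemma one_in_annulus: "1 \<in> annulus"
  using q0 q1 by (auto simp: annulus_def)

lemma annulus_nonzero: "z \<in> annulus \<Longrightarrow> z \<noteq> 0"
  by (auto simp: annulus_def)

lemma inverse_in_annulus: "z \<in> annulus \<Longrightarrow> 1 / z \<in> annulus"
  using q0 by (auto simp: annulus_def norm_divide divide_simps mult.commute)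

lemma norm_annulus_mult_power:
  assumes "z \<in> annulus"
  shows "norm (z * q ^ Suc n) < norm q ^ n"
proof -
  have "norm z * norm q < 1"
    using assms q0 by (simp add: annulus_def field_simps)
  then have "norm z * norm q * norm q ^ n < 1 * norm q ^ n"
    using q0 by (intro mult_strict_right_mono) auto
  then show ?thesis
    by (simp add: norm_mult norm_power mult_ac)
qed

lemma annulus_mult_power_neq_1:
  assumes "z \<in> annulus"
  shows "z * q ^ Suc n \<noteq> 1"
proof -
  have "norm (z * q ^ Suc n) < 1"
    using norm_annulus_mult_power[OF assms, of n] q1 power_le_one[of "norm q" n] by simp
  then show ?thesis
    by auto
qed

text \<open>Negative exponents reduce to positive ones at \<open>1 / z\<close>, by the inversion
  symmetry of the annulus.\<close>

lemma annulus_mult_powi_neq_1: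
  assumes "z \<in> annulus" "k \<noteq> 0"
  shows "z * q powi k \<noteq> 1"
proof (cases k rule: int_cases3)
  case (pos n)
  then obtain m where "n = Suc m"
    using gr0_conv_Suc by blast
  then have "q powi k = q ^ Suc m"
    using pos by (metis power_int_of_nat)
  then show ?thesis
    using annulus_mult_power_neq_1[OF assms(1), of m] by metis
next
  case (neg n)
  then obtain m where "n = Suc m"
    using gr0_conv_Suc by blast
  then have *: "q powi k = 1 / q ^ Suc m"
    using neg by (metis power_int_minus power_int_of_nat inverse_eq_divide)
  have "q ^ Suc m \<noteq> 0"
    using q0 by auto
  then show ?thesis
    using annulus_mult_power_neq_1[OF inverse_in_annulus[OF assms(1)], of m]
      annulus_nonzero[OF assms(1)]
    unfolding * by (auto simp: divide_simps simp del: power_Suc)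
qed (use assms in auto)

text \<open>Every orbit of multiplication by \<open>q\<close> meets the closed annulus
  \<open>sqrt \<bar>q\<bar> \<le> \<bar>z\<bar> \<le> 1 / sqrt \<bar>q\<bar>\<close>, so the modulus attains its maximum in the open annulus.\<close>
lemma q_periodic_const:
  assumes holo: "f holomorphic_on annulus - {1}"
    and per: "\<And>z. 1 < norm z \<Longrightarrow> norm z < 1 / norm q \<Longrightarrow> f (q * z) = f z"
    and lim: "(f \<longlongrightarrow> l) (at 1)"
    and z: "z \<in> annulus" "z \<noteq> 1"
  shows "f z = l"
proof -
  \<comment> \<open>The limit \<open>l\<close> removes the singularity at 1, so that
    \<open>g\<close> is holomorphic on the whole annulus.\<close>
  define g where "g = f(1 := l)"
  define r where "r = sqrt (norm q)"
  have r: "0 < r" "r < 1" "r * r = norm q"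
    using q0 q1 by (auto simp: r_def)
  have rq: "norm q < r"
    using mult_strict_left_mono[OF r(2,1)] r(3) by simp
  then have rq': "1 / r < 1 / norm q"
    using divide_strict_left_mono[OF _ _ mult_pos_pos[OF r(1) q0], of 1] by simp
  have "1 < 1 / r"
    using r(1,2) by simp
  note rq' = rq' this
  have holo_g: "g holomorphic_on annulus"
  proof (rule no_isolated_singularity'[where K = "{1}"])
    have "g holomorphic_on annulus - {1} \<longleftrightarrow> f holomorphic_on annulus - {1}"
      by (intro holomorphic_cong) (auto simp: g_def)
    with holo show "g holomorphic_on annulus - {1}"
      by simp
    have "(g \<longlongrightarrow> l) (at 1)"
      using lim by (rule Lim_transform_eventually) (auto simp: g_def eventually_at_filter)
    then show "(g \<longlongrightarrow> g z) (at z within annulus)" if "z \<in> {1}" for z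
      using that by (auto simp: g_def intro: tendsto_within_subset)
  qed (auto simp: open_annulus)
  \<comment> \<open>These are exactly the \<open>z\<close> for which \<open>z\<close> and
    \<open>q * z\<close> both lie in the annulus. Their moduli are on opposite sides of 1, so
    neither meets the modified value.\<close>
  have per_g: "g (q * z) = g z" if "1 < norm z" "norm z < 1 / norm q" for z
  proof -
    have "norm (q * z) < 1"
      using that q0 by (simp add: norm_mult field_simps)
    then show ?thesis
      using that per by (auto simp: g_def)
  qed
  define K where "K = cball (0::complex) (1 / r) - ball 0 r"
  have "compact K"
    unfolding K_def by (intro compact_diff) auto
  moreover have "1 \<in> K"
    using r rq' by (auto simp: K_def)
  moreover have "K \<subseteq> annulus"
    using rq rq' by (auto simp: K_def annulus_def)
  moreover from this have "continuous_on K (\<lambda>z. norm (g z))"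
    using holomorphic_on_imp_continuous_on[OF holo_g]
    by (intro continuous_intros) (auto intro: continuous_on_subset)
  ultimately obtain x where x: "x \<in> K" "\<And>z. z \<in> K \<Longrightarrow> norm (g z) \<le> norm (g x)"
    using continuous_attains_sup[of K "\<lambda>z. norm (g z)"] by blast
  \<comment> \<open>A point outside \<open>K\<close> enters \<open>K\<close> after one
    multiplication or one division by \<open>q\<close>, so the maximum over \<open>K\<close> is the
    maximum over the open annulus.\<close>
  have max: "norm (g z) \<le> norm (g x)" if z: "z \<in> annulus" for z
  proof -
    consider "z \<in> K" | "norm z > 1 / r" | "norm z < r"
      unfolding K_def by fastforce
    then show ?thesis
    proof cases
      case 2
      then have "1 < norm z"
        using rq' by linarith
      then have "g (q * z) = g z"
        using z by (intro per_g) (auto simp: annulus_def)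
      moreover have "q * z \<in> K"
      proof -
        have "r * r * norm z < 1"
          using z q0 r(3) by (simp add: annulus_def field_simps)
        moreover have "1 < r * norm z"
          using 2 r(1) by (simp add: field_simps)
        then have "r * 1 < r * (r * norm z)"
          using r(1) by (rule mult_strict_left_mono)
        moreover have "r * (r * norm z) = norm (q * z)" "r * r * norm z = norm (q * z)"
          by (simp_all add: norm_mult flip: r(3))
        ultimately have "norm (q * z) < 1" "r < norm (q * z)"
          by simp_all
        then show ?thesis
          using rq' by (auto simp: K_def)
      qed
      ultimately show ?thesis
        using x(2)[of "q * z"] by simp
    next
      case 3
      have n: "1 < norm (z / q)" "norm (z / q) < 1 / r"
      proof -
        show "1 < norm (z / q)"
          using z q0 by (simp add: annulus_def norm_divide)
        have "r * norm z < r * r"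
          using 3 r(1) by (rule mult_strict_left_mono)
        then show "norm (z / q) < 1 / r"
          using r q0 by (simp add: norm_divide field_simps)
      qed
      then have "g (q * (z / q)) = g (z / q)"
        using rq' by (intro per_g) auto
      moreover have "z / q \<in> K"
        using n r by (auto simp: K_def)
      ultimately show ?thesis
        using x(2)[of "z / q"] q0 by simp
    qed (use x in simp)
  qed
  have "connected annulus"
    unfolding annulus_def using connected_annulus(1)[of "norm q" "0 :: complex" "1 / norm q"] by simp
  then have "g constant_on annulus"
    using maximum_modulus_principle[OF holo_g open_annulus _ open_annulus, of x]
      x(1) \<open>K \<subseteq> annulus\<close> max by blast
  then have "g z = g 1"
    using z one_in_annulus by (auto simp: constant_on_def)
  then show ?thesis
    using z by (simp add: g_def)
qed

subsection \<open>Bilateral series on the annulus\<close>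

text \<open>Adding \<open>k * 2\<close> to the numerator adds exactly \<open>k\<close> to the
  integer quotient, so no parity argument enters. This identity serves the reflection of the index,
  the next one its shift.\<close>

lemma tri_minus: "(- k) * (- k + 1) div 2 + k = k * (k + 1) div (2 :: int)"
proof -
  have "((- k) * (- k + 1) + k * 2) div 2 = k + (- k) * (- k + 1) div 2"
    by (rule div_mult_self1) simp
  moreover have "(- k) * (- k + 1) + k * 2 = k * (k + 1)"
    by (simp add: algebra_simps)
  ultimately show ?thesis
    by (simp only: add.commute)
qed

lemma tri_pred: "(k - 1) * k div 2 + k = k * (k + 1) div (2 :: int)"
proof -
  have "((k - 1) * k + k * 2) div 2 = k + (k - 1) * k div 2"
    by (rule div_mult_self1) simp
  moreover have "(k - 1) * k + k * 2 = k * (k + 1)"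
    by (simp add: algebra_simps)
  ultimately show ?thesis
    by (simp only: add.commute)
qed

text \<open>The case \<open>e = 0\<close> is the partial fraction expansion of a reciprocal theta function, the case
  \<open>e = 1\<close> the Appell sum of the theorem.\<close>
definition bilateral_term :: "nat \<Rightarrow> int \<Rightarrow> complex \<Rightarrow> complex" where
  "bilateral_term e k =
    (\<lambda>z. (- 1) powi k * z powi (int e * k) * q powi (k * (k + 1) div 2) / (1 - z * q powi k))"

lemma bilateral_term_of_nat:
  "bilateral_term e (int n) z = (- 1) ^ n * (z ^ (e * n) * q ^ (n * (n + 1) div 2) / (1 - z * q ^ n))"
proof -
  have "int e * int n = int (e * n)" "int n * (int n + 1) div 2 = int (n * (n + 1) div 2)"
    by (simp_all only: zdiv_int of_nat_mult of_nat_add of_nat_1 of_nat_numeral minus_mult_right)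
  then show ?thesis
    unfolding bilateral_term_def by (simp only: power_int_of_nat) (simp add: mult.assoc)
qed

text \<open>Reflecting the index replaces \<open>z\<close> by \<open>1 / z\<close> and raises the
  exponent by one, so one estimate covers both halves of the series.\<close>

lemma bilateral_term_minus_of_nat:
  assumes "z \<noteq> 0"
  shows "bilateral_term e (- int n) z =
    - ((- 1) ^ n) * ((1 / z) ^ (e * n + 1) * q ^ (n * (n + 1) div 2) / (1 - 1 / z * q ^ n))"
proof -
  have e: "int e * - int n = - int (e * n)" "int n * (int n + 1) div 2 = int (n * (n + 1) div 2)"
    by (simp_all only: zdiv_int of_nat_mult of_nat_add of_nat_1 of_nat_numeral minus_mult_right)
  have "q powi (- int n * (- int n + 1) div 2) * q powi int n = q powi (int n * (int n + 1) div 2)"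
    using q0 tri_minus[of "int n"] by (subst power_int_add[symmetric]) auto
  then have q: "q powi (- int n * (- int n + 1) div 2) = q ^ (n * (n + 1) div 2) / q ^ n"
    using q0 unfolding e by (simp add: field_simps)
  have qn: "q ^ n \<noteq> 0"
    using q0 by simp
  have "x / q ^ n / (1 - z / q ^ n) = - (1 / z * x / (1 - 1 / z * q ^ n))" for x
  \<comment> \<open>If \<open>z = q ^ n\<close>, both denominators vanish and both sides are 0 by
    the convention for division.\<close>
  proof (cases "z = q ^ n")
    case False
    then show ?thesis
      using qn assms q0 by (simp add: divide_simps) (auto simp add: algebra_simps)
  qed (use qn q0 in simp)
  note frac = this[of "q ^ (n * (n + 1) div 2)"]
  have p1: "(- 1 :: complex) powi (- int n) = (- 1) ^ n"
    by (simp only: power_int_minus_one_minus power_int_of_nat)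
  have p: "z powi (int e * - int n) = (1 / z) ^ (e * n)"
    "z * q powi - int n = z / q ^ n"
    by (simp_all only: e(1) power_int_minus power_int_of_nat
        inverse_eq_divide power_one_over times_divide_eq_right mult_1_right)
  have "bilateral_term e (- int n) z = (- 1) ^ n * (1 / z) ^ (e * n) *
      (q ^ (n * (n + 1) div 2) / q ^ n / (1 - z / q ^ n))"
    by (simp only: bilateral_term_def p1 p q times_divide_eq_right)
  then show ?thesis
    unfolding frac by (simp add: power_add mult_ac)
qed

text \<open>Since \<open>|y q| <= 1\<close>, \<open>m\<close> factors \<open>q\<close> absorb
  \<open>y ^ m\<close>. For \<open>m <= n + 1\<close> the Gaussian exponent provides
  \<open>n + m\<close> factors as soon as \<open>n >= 4\<close>. The constant 2 comes from the
  denominator, whose modulus is at least \<open>1 / 2\<close>.\<close>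

lemma norm_theta_term_le:
  assumes y: "y \<in> annulus" and n: "m \<le> n + 1" "4 \<le> n" "norm q ^ (n - 1) \<le> 1 / 2"
  shows "norm (y ^ m * q ^ (n * (n + 1) div 2) / (1 - y * q ^ n)) \<le> 2 * norm q ^ n"
proof -
  have "norm y * norm q \<le> 1"
    using y q0 by (simp add: annulus_def field_simps)
  then have 1: "(norm y * norm q) ^ m \<le> 1"
    by (intro power_le_one) auto
  have "n * 5 \<le> n * (n + 1)"
    using n by (intro mult_le_mono) auto
  then have "n + m \<le> n * (n + 1) div 2"
    using n by linarith
  then have "norm q ^ (n * (n + 1) div 2) \<le> norm q ^ (n + m)"
    using q1 by (intro power_decreasing) auto
  then have "norm y ^ m * norm q ^ (n * (n + 1) div 2) \<le> norm y ^ m * norm q ^ (n + m)"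
    by (intro mult_left_mono) auto
  also have "\<dots> = (norm y * norm q) ^ m * norm q ^ n"
    by (simp add: power_add power_mult_distrib)
  also have "\<dots> \<le> norm q ^ n"
    using mult_right_mono[OF 1, of "norm q ^ n"] by simp
  finally have num: "norm (y ^ m * q ^ (n * (n + 1) div 2)) \<le> norm q ^ n"
    by (simp add: norm_mult norm_power)
  have "norm (y * q ^ n) \<le> 1 / 2"
    using norm_annulus_mult_power[OF y, of "n - 1"] n by simp
  then have "1 / 2 \<le> norm (1 - y * q ^ n)"
    using norm_triangle_ineq2[of 1 "y * q ^ n"] by simp
  then have "norm (y ^ m * q ^ (n * (n + 1) div 2) / (1 - y * q ^ n)) \<le> norm q ^ n / (1 / 2)"
    unfolding norm_divide using num by (intro frac_le) auto
  then show ?thesis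
    by simp
qed

lemma eventually_power_small: "\<forall>\<^sub>F n in sequentially. 4 \<le> n \<and> norm q ^ (n - 1) \<le> 1 / 2"
proof -
  obtain N where N: "norm q ^ N < 1 / 2"
    using real_arch_pow_inv[of "1 / 2" "norm q"] q1 by auto
  have "4 \<le> n \<and> norm q ^ (n - 1) \<le> 1 / 2" if "n \<ge> N + 4" for n
  proof -
    have "norm q ^ (n - 1) \<le> norm q ^ N"
      using that q1 by (intro power_decreasing) auto
    then show ?thesis
      using N that by linarith
  qed
  then show ?thesis
    unfolding eventually_sequentially by blast
qed

lemma eventually_norm_bilateral_term_le:
  assumes "e \<le> 1"
  shows "\<forall>\<^sub>F n in sequentially. \<forall>z\<in>annulus.
    norm (bilateral_term e (int n) z) \<le> 2 * norm q ^ n \<and> norm (bilateral_term e (- int n) z) \<le> 2 * norm q ^ n"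
  using eventually_power_small
proof eventually_elim
  case (elim n)
  have "e * n \<le> 1 * n"
    using assms by (intro mult_le_mono1)
  then have le: "e * n \<le> n + 1" "e * n + 1 \<le> n + 1"
    by linarith+
  note bound = norm_theta_term_le[OF _ _ elim[THEN conjunct1] elim[THEN conjunct2]]
  show ?case
  proof (intro ballI conjI)
    fix z assume z: "z \<in> annulus"
    show "norm (bilateral_term e (int n) z) \<le> 2 * norm q ^ n"
      using bound[OF z le(1)]
      by (simp only: bilateral_term_of_nat norm_mult[of "(- 1) ^ n"] norm_power[of "- 1"] norm_minus_cancel
          norm_one power_one mult_1)
    show "norm (bilateral_term e (- int n) z) \<le> 2 * norm q ^ n"
      using bound[OF inverse_in_annulus[OF z] le(2)] bilateral_term_minus_of_nat[OF annulus_nonzero[OF z]]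
      by (simp only: minus_mult_left[symmetric] norm_mult[of "(- 1) ^ n"] norm_power[of "- 1"]
          norm_minus_cancel norm_one power_one mult_1)
  qed
qed

definition bilateral_term_pair :: "nat \<Rightarrow> nat \<Rightarrow> complex \<Rightarrow> complex" where
  "bilateral_term_pair e n = (\<lambda>z. bilateral_term e (int (Suc n)) z + bilateral_term e (- int (Suc n)) z)"

text \<open>The bilateral series without its singular term \<open>1 / (1 - z)\<close>. For
  \<open>e <= 1\<close> it is holomorphic on the whole annulus, including 1.\<close>

definition tail :: "nat \<Rightarrow> complex \<Rightarrow> complex" where
  "tail e = (\<lambda>z. \<Sum>n. bilateral_term_pair e n z)"

lemma bilateral_term_0: "bilateral_term e 0 z = 1 / (1 - z)"
  by (simp add: bilateral_term_def)

lemma summable_norm_q: "summable (\<lambda>n. c * norm q ^ n)"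
  using q1 by (intro summable_mult summable_geometric) simp

lemma infsum_bilateral_term:
  assumes "z \<in> annulus" "e \<le> 1"
  shows "(\<lambda>k. bilateral_term e k z) summable_on UNIV"
    and "(\<Sum>\<^sub>\<infinity>k. bilateral_term e k z) = 1 / (1 - z) + tail e z"
proof -
  have "((\<lambda>k. bilateral_term e k z) has_sum tail e z) (UNIV - {0})"
    unfolding tail_def bilateral_term_pair_def
    by (rule has_sum_int_nonzero[OF summable_norm_q[of 2]];
        rule eventually_mono[OF eventually_norm_bilateral_term_le[OF assms(2)]]) (use assms in auto)
  from infsum_int_split_zero[OF this] show "(\<lambda>k. bilateral_term e k z) summable_on UNIV"
    "(\<Sum>\<^sub>\<infinity>k. bilateral_term e k z) = 1 / (1 - z) + tail e z"
    by (simp_all add: bilateral_term_0)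
qed

lemma bilateral_term_holomorphic: "k \<noteq> 0 \<Longrightarrow> bilateral_term e k holomorphic_on annulus"
  unfolding bilateral_term_def
  by (intro holomorphic_intros) (use annulus_mult_powi_neq_1 annulus_nonzero in auto)

lemma eventually_norm_bilateral_term_pair_le:
  assumes "e \<le> 1"
  shows "\<forall>\<^sub>F n in sequentially. \<forall>z\<in>annulus. norm (bilateral_term_pair e n z) \<le> 4 * norm q * norm q ^ n"
proof -
  have "\<forall>\<^sub>F n in sequentially. \<forall>z\<in>annulus. norm (bilateral_term e (int (Suc n)) z) \<le> 2 * norm q ^ Suc n \<and>
      norm (bilateral_term e (- int (Suc n)) z) \<le> 2 * norm q ^ Suc n"
    using eventually_norm_bilateral_term_le[OF assms] by (rule eventually_sequentially_Suc[THEN iffD2])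
  then show ?thesis
  proof eventually_elim
    case (elim n)
    show ?case
    proof
      fix z assume "z \<in> annulus"
      with elim have "norm (bilateral_term e (int (Suc n)) z) \<le> 2 * norm q ^ Suc n"
        "norm (bilateral_term e (- int (Suc n)) z) \<le> 2 * norm q ^ Suc n"
        by blast+
      then show "norm (bilateral_term_pair e n z) \<le> 4 * norm q * norm q ^ n"
        using norm_triangle_ineq[of "bilateral_term e (int (Suc n)) z" "bilateral_term e (- int (Suc n)) z"]
        unfolding bilateral_term_pair_def power_Suc by linarith
    qed
  qed
qed

lemma bilateral_term_pair_holomorphic: "bilateral_term_pair e n holomorphic_on annulus"
  unfolding bilateral_term_pair_def
  by (rule holomorphic_on_add; rule bilateral_term_holomorphic) (simp_all del: of_nat_Suc)

lemmas tail_M_test = holomorphic_series_M_test[OF open_annulus bilateral_term_pair_holomorphic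
    summable_norm_q eventually_norm_bilateral_term_pair_le, folded tail_def]

lemma tail_has_derivative:
  "e \<le> 1 \<Longrightarrow> (tail e has_field_derivative deriv (tail e) 1) (at 1)"
  using holomorphic_derivI[OF tail_M_test(1) open_annulus one_in_annulus] by simp

text \<open>The factor \<open>z powi k\<close> has value 1 and derivative \<open>k\<close> at 1.
  Hence the two tails agree there, while their derivatives differ by a series with weights
  \<open>k\<close>.\<close>

lemma bilateral_term_1_eq: "bilateral_term 1 k = (\<lambda>z. z powi k * bilateral_term 0 k z)"
  by (simp add: bilateral_term_def fun_eq_iff)

lemma deriv_bilateral_term_1:
  assumes "k \<noteq> 0"
  shows "(bilateral_term 1 k has_field_derivative
      deriv (bilateral_term 0 k) 1 + of_int k * bilateral_term 0 k 1) (at 1)"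
proof -
  have "(bilateral_term 0 k has_field_derivative deriv (bilateral_term 0 k) 1) (at 1)"
    using holomorphic_derivI[OF bilateral_term_holomorphic[OF assms] open_annulus one_in_annulus] .
  then show ?thesis
    unfolding bilateral_term_1_eq by (auto intro!: derivative_eq_intros simp: algebra_simps)
qed

text \<open>Termwise differentiation at 1: the derivatives of the \<open>e = 0\<close> terms cancel,
  and what remains is the second sum of the theorem.\<close>

lemma tail_diff_has_derivative:
  "((\<lambda>z. tail 1 z - tail 0 z) has_field_derivative
     (\<Sum>\<^sub>\<infinity>k\<in>UNIV - {0}. of_int k * bilateral_term 0 k 1)) (at 1)"
proof -
  define h where "h k = of_int k * bilateral_term 0 k 1" for k
  have d0: "(bilateral_term 0 k has_field_derivative deriv (bilateral_term 0 k) 1) (at 1)" if "k \<noteq> 0" for k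
    using holomorphic_derivI[OF bilateral_term_holomorphic[OF that] open_annulus one_in_annulus] .
  have p0: "deriv (bilateral_term_pair 0 n) 1 =
      deriv (bilateral_term 0 (int (Suc n))) 1 + deriv (bilateral_term 0 (- int (Suc n))) 1" for n
    unfolding bilateral_term_pair_def by (intro DERIV_imp_deriv DERIV_add d0) auto
  have p1: "deriv (bilateral_term_pair 1 n) 1 =
      (deriv (bilateral_term 0 (int (Suc n))) 1 + h (int (Suc n))) +
      (deriv (bilateral_term 0 (- int (Suc n))) 1 + h (- int (Suc n)))" for n
    unfolding bilateral_term_pair_def h_def by (intro DERIV_imp_deriv DERIV_add deriv_bilateral_term_1) auto
  have "(\<lambda>n. deriv (bilateral_term_pair 1 n) 1 - deriv (bilateral_term_pair 0 n) 1) sums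
      (deriv (tail 1) 1 - deriv (tail 0) 1)"
    by (intro sums_diff tail_M_test(3) one_in_annulus) auto
  then have "(\<lambda>n. h (int (Suc n)) + h (- int (Suc n))) sums (deriv (tail 1) 1 - deriv (tail 0) 1)"
    unfolding p0 p1 by (simp add: algebra_simps)
  moreover have "(h has_sum (\<Sum>n. h (int (Suc n)) + h (- int (Suc n)))) (UNIV - {0})"
  proof (rule has_sum_int_nonzero)
    \<comment> \<open>The weight \<open>k\<close> in \<open>h\<close> adds a factor \<open>n\<close>
      to the majorant, which is then a differentiated geometric series.\<close>
    have "summable (\<lambda>n. of_nat (Suc n) * norm q ^ n)"
      using geometric_deriv_sums[of "norm q"] q1 by (auto simp: sums_iff)
    then have "summable (\<lambda>n. 2 * norm q * (of_nat (Suc n) * norm q ^ n))"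
      by (rule summable_mult)
    moreover have "(\<lambda>n. 2 * norm q * (of_nat (Suc n) * norm q ^ n)) =
        (\<lambda>n. of_nat (Suc n) * (2 * norm q ^ Suc n))"
      by (simp only: power_Suc mult_ac)
    ultimately show "summable (\<lambda>n. of_nat n * (2 * norm q ^ n))"
      using summable_Suc_iff[of "\<lambda>n. of_nat n * (2 * norm q ^ n)"] by metis
    show "\<forall>\<^sub>F n in sequentially. norm (h (int n)) \<le> of_nat n * (2 * norm q ^ n)"
      "\<forall>\<^sub>F n in sequentially. norm (h (- int n)) \<le> of_nat n * (2 * norm q ^ n)"
      unfolding h_def norm_mult norm_of_int
      by (rule eventually_mono[OF eventually_norm_bilateral_term_le[of 0]], simp,
          rule mult_mono, use one_in_annulus in auto)+
  qed
  ultimately have "infsum h (UNIV - {0}) = deriv (tail 1) 1 - deriv (tail 0) 1"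
    using infsumI sums_unique by metis
  then show ?thesis
    unfolding h_def using DERIV_diff[OF tail_has_derivative tail_has_derivative, of 1 0] by simp
qed

lemma tail_1_1: "tail 1 1 = tail 0 1"
  unfolding tail_def bilateral_term_pair_def bilateral_term_1_eq by simp

subsection \<open>Theta products\<close>

lemma summable_norm_power_q: "summable (\<lambda>n. norm (q ^ n))"
  using q1 by (simp add: norm_power summable_geometric)

lemma qpoch_inf_eq: "qpoch_inf a q = (\<Prod>k. 1 - q ^ k * a)"
  by (simp add: qpoch_inf_def mult.commute)

lemma qpoch_inf_holomorphic: "(\<lambda>a. qpoch_inf a q) holomorphic_on A"
  unfolding qpoch_inf_eq by (rule holomorphic_prod_linear[OF summable_norm_power_q])

lemma convergent_prod_qpoch: "convergent_prod (\<lambda>k. 1 - a * q ^ k)"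
  using convergent_prod_linear[OF summable_norm_power_q, of a] by (simp add: mult.commute)

lemma qpoch_inf_split: "qpoch_inf a q = (1 - a) * qpoch_inf (q * a) q"
  using has_prod_ignore_initial_segment'[OF convergent_prod_qpoch, of a 1]
  by (simp add: qpoch_inf_def has_prod_iff mult_ac)

lemma qpoch_inf_annulus_nonzero:
  assumes "z \<in> annulus"
  shows "qpoch_inf (q * z) q \<noteq> 0"
  unfolding qpoch_inf_def
proof (rule prodinf_nonzero[OF convergent_prod_qpoch])
  show "1 - q * z * q ^ k \<noteq> 0" for k
    using annulus_mult_power_neq_1[OF assms, of k] by (simp add: mult_ac)
qed

lemma qtheta_split:
  "qtheta z q = (1 - z) * (qpoch_inf (q * z) q * qpoch_inf (q / z) q)"
  using qpoch_inf_split[of z] by (simp add: qtheta_def)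

text \<open>Passing from \<open>x\<close> to \<open>q * x\<close> trades the factor
  \<open>1 - x\<close> for \<open>1 - 1 / x\<close>, and
  \<open>1 - x = - x * (1 - 1 / x)\<close>.\<close>

lemma qtheta_shift:
  assumes "x \<noteq> 0" "x \<noteq> 1"
  shows "qtheta x q = - x * qtheta (q * x) q"
proof -
  have "qtheta (q * x) q = qpoch_inf (q * x) q * qpoch_inf (1 / x) q"
    using q0 by (simp add: qtheta_def)
  also have "qpoch_inf (1 / x) q = (1 - 1 / x) * qpoch_inf (q / x) q"
    using qpoch_inf_split[of "1 / x"] by simp
  finally show ?thesis
    using assms(1) by (simp add: qtheta_split[of x]) (simp add: field_simps)
qed

definition theta_coeff :: "nat \<Rightarrow> complex" where
  "theta_coeff n = q ^ Suc n / (1 - q ^ Suc n)\<^sup>2"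

text \<open>The function \<open>H\<close> of the outline: at \<open>w = (1 - z)^2 / z\<close> it
  equals \<open>(q z; q) (q / z; q) / (q; q)^2\<close>.\<close>

definition theta_prod :: "complex \<Rightarrow> complex" where
  "theta_prod = (\<lambda>w. \<Prod>n. 1 - theta_coeff n * w)"

lemma q_power_Suc_neq_1: "q ^ Suc n \<noteq> 1"
  using annulus_mult_power_neq_1[OF one_in_annulus, of n] by simp

definition double_pole :: "complex \<Rightarrow> nat \<Rightarrow> complex" where
  "double_pole y n = y * q ^ n / (1 - y * q ^ n)\<^sup>2"

lemma norm_double_pole_le:
  assumes "norm (y * q ^ n) \<le> 1 / 2"
  shows "norm (double_pole y n) \<le> 4 * norm (y * q ^ n)"
proof -
  have "1 / 2 \<le> norm (1 - y * q ^ n)"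
    using norm_triangle_ineq2[of 1 "y * q ^ n"] assms by simp
  then have "(1 / 2)\<^sup>2 \<le> (norm (1 - y * q ^ n))\<^sup>2"
    by (intro power_mono) auto
  then have "norm (y * q ^ n) / (norm (1 - y * q ^ n))\<^sup>2 \<le> norm (y * q ^ n) / (1 / 2)\<^sup>2"
    by (intro frac_le) auto
  then show ?thesis
    by (simp add: double_pole_def norm_divide norm_power power_divide mult.commute)
qed

text \<open>Only the indices with \<open>|y q^n| < 1 / 2\<close> matter. A vanishing denominator at
  an earlier index merely gives the term 0.\<close>

lemma summable_norm_double_pole: "summable (\<lambda>n. norm (double_pole y n))"
proof (rule summable_comparison_test_ev)
  have "(\<lambda>n. norm y * norm q ^ n) \<longlonglongrightarrow> norm y * 0"
    using q1 by (intro tendsto_intros LIMSEQ_power_zero) auto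
  then have "\<forall>\<^sub>F n in sequentially. norm y * norm q ^ n < 1 / 2"
    by (rule order_tendstoD) simp
  then show "\<forall>\<^sub>F n in sequentially. norm (norm (double_pole y n)) \<le> 4 * norm y * norm q ^ n"
  proof eventually_elim
    case (elim n)
    then show ?case
      using norm_double_pole_le[of y n] by (simp add: norm_mult norm_power)
  qed
qed (rule summable_norm_q)

lemmas summable_double_pole = summable_norm_cancel[OF summable_norm_double_pole]

lemma theta_coeff_eq_double_pole: "theta_coeff = double_pole q"
  by (simp add: fun_eq_iff theta_coeff_def double_pole_def)

lemma summable_norm_theta_coeff: "summable (\<lambda>n. norm (theta_coeff n))"
  unfolding theta_coeff_eq_double_pole by (rule summable_norm_double_pole)

lemma theta_prod_holomorphic: "theta_prod holomorphic_on A"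
  unfolding theta_prod_def by (rule holomorphic_prod_linear[OF summable_norm_theta_coeff])

lemma theta_prod_0: "theta_prod 0 = 1"
  by (simp add: theta_prod_def)

lemma theta_prod_has_derivative_0: "(theta_prod has_field_derivative - suminf theta_coeff) (at 0)"
  unfolding theta_prod_def by (rule prod_linear_has_derivative_0[OF summable_norm_theta_coeff])

text \<open>The product is invariant under \<open>z \<mapsto> 1 / z\<close>, so it is a function of \<open>z + 1 / z - 2\<close>, which
  vanishes to second order at 1.\<close>
lemma qpoch_prod_eq_theta_prod:
  assumes "z \<noteq> 0"
  shows "qpoch_inf (q * z) q * qpoch_inf (q / z) q = (qpoch_inf q q)\<^sup>2 * theta_prod ((1 - z)\<^sup>2 / z)"
proof -
  have "(1 - q * z * q ^ n) * (1 - q / z * q ^ n) =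
      (1 - q * q ^ n) * (1 - q * q ^ n) * (1 - theta_coeff n * ((1 - z)\<^sup>2 / z))" for n
  proof -
    define x where "x = q * q ^ n"
    have cancel: "D * D * (1 - x / D\<^sup>2 * t) = D * D - x * t" if "D \<noteq> 0" for D t
      using that by (simp add: right_diff_distrib power2_eq_square)
    have "1 - x \<noteq> 0"
      using q_power_Suc_neq_1[of n] by (simp add: x_def)
    then have "(1 - x) * (1 - x) * (1 - x / (1 - x)\<^sup>2 * ((1 - z)\<^sup>2 / z)) =
        (1 - x) * (1 - x) - x * ((1 - z)\<^sup>2 / z)"
      by (rule cancel)
    \<comment> \<open>Both sides are \<open>1 - x * (z + 1 / z) + x^2\<close>.\<close>
    also have "\<dots> = (1 - x * z) * (1 - x / z)"
      using assms by (simp add: field_simps power2_eq_square)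
    finally show ?thesis
      by (simp add: theta_coeff_def x_def mult_ac)
  qed
  then show ?thesis
    unfolding qpoch_inf_def theta_prod_def power2_eq_square[of "prodinf _"]
    by (simp only: prodinf_mult convergent_prod_mult convergent_prod_qpoch
        convergent_prod_linear[OF summable_norm_theta_coeff])
qed

lemma qpoch_inf_q_nonzero: "qpoch_inf q q \<noteq> 0"
  using qpoch_inf_annulus_nonzero[OF one_in_annulus] by simp

lemma theta_prod_nonzero:
  assumes "z \<in> annulus"
  shows "theta_prod ((1 - z)\<^sup>2 / z) \<noteq> 0"
  using qpoch_prod_eq_theta_prod[OF annulus_nonzero[OF assms]] qpoch_inf_annulus_nonzero[OF assms]
    qpoch_inf_annulus_nonzero[OF inverse_in_annulus[OF assms]] by auto

section \<open>Partial fractions of the reciprocal theta function\<close>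

lemma bij_int_pred: "bij (\<lambda>k::int. k - 1)"
  by (rule bij_betw_byWitness[where f' = "\<lambda>k. k + 1"]) auto

lemma q_powi_tri_pred: "q powi (k * (k + 1) div 2) = q powi ((k - 1) * k div 2) * q powi k"
  using q0 by (subst power_int_add[symmetric]) (auto simp: tri_pred)

text \<open>Term \<open>k - 1\<close> at \<open>q * z\<close> and term \<open>k\<close> at
  \<open>z\<close> share the denominator \<open>1 - z * q powi k\<close>. In the combination
  \<open>eq\<close> it cancels and leaves an alternating Gaussian series with sum 0.\<close>

lemma sum_bilateral_term_0_shift:
  assumes z: "z \<in> annulus" "q * z \<in> annulus" "z \<noteq> 1"
  shows "(\<Sum>\<^sub>\<infinity>k. bilateral_term 0 k (q * z)) = - z * (\<Sum>\<^sub>\<infinity>k. bilateral_term 0 k z)"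
proof -
  define s where "s k = (- 1) powi k * q powi ((k - 1) * k div 2)" for k
  \<comment> \<open>The reflection of \<open>k\<close> to \<open>1 - k\<close> fixes the exponent of
    \<open>q\<close> and flips the sign, so the sum equals its own negative.\<close>
  have "infsum s UNIV = (\<Sum>\<^sub>\<infinity>k. s (1 - k))"
    by (rule infsum_reindex_bij_betw[symmetric], rule bij_betw_byWitness[where f' = "\<lambda>k. 1 - k"]) auto
  also have "\<dots> = (\<Sum>\<^sub>\<infinity>k. - s k)"
  proof (rule infsum_cong)
    fix k :: int
    have "(1 - k - 1) * (1 - k) = (k - 1) * k"
      by (simp add: algebra_simps)
    moreover have "(- 1 :: complex) powi (1 - k) = - ((- 1) powi k)"
      unfolding diff_conv_add_uminus[of 1 k]
      by (subst power_int_add) (simp_all only: power_int_minus_one_minus power_int_1_right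
          mult_minus1, simp)
    ultimately show "s (1 - k) = - s k"
      by (simp only: s_def mult_minus_left)
  qed
  also have "\<dots> = - infsum s UNIV"
    by (rule infsum_uminus)
  finally have s: "infsum s UNIV = 0"
    by simp
  have eq: "z * bilateral_term 0 k z + bilateral_term 0 (k - 1) (q * z) = - s k" for k
  proof -
    have nz: "1 - z * q powi k \<noteq> 0"
      using annulus_mult_powi_neq_1[OF z(1), of k] z(3) by (cases "k = 0") auto
    define X where "X = q powi ((k - 1) * k div 2)"
    have "q * z * q powi (k - 1) = z * q powi k" "(k - 1) * (k - 1 + 1) = (k - 1) * k"
      using q0 by (simp_all add: power_int_diff)
    then have 1: "bilateral_term 0 (k - 1) (q * z) = - ((- 1) powi k * X / (1 - z * q powi k))"
      unfolding bilateral_term_def X_def by (simp only:) (simp add: power_int_diff)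
    have 2: "bilateral_term 0 k z = (- 1) powi k * (X * q powi k) / (1 - z * q powi k)"
      by (simp only: bilateral_term_def q_powi_tri_pred X_def) simp
    have "z * (S * (X * Y) / (1 - z * Y)) + - (S * X / (1 - z * Y)) = - (S * X)"
      if "1 - z * Y \<noteq> 0" for S Y
      using that by (simp add: divide_simps) (simp add: algebra_simps)
    from this[OF nz] show ?thesis
      unfolding 1 2 s_def X_def .
  qed
  have "(\<Sum>\<^sub>\<infinity>k. z * bilateral_term 0 k z + bilateral_term 0 (k - 1) (q * z)) =
      (\<Sum>\<^sub>\<infinity>k. z * bilateral_term 0 k z) + (\<Sum>\<^sub>\<infinity>k. bilateral_term 0 (k - 1) (q * z))"
    using infsum_bilateral_term(1)[OF z(1), of 0] infsum_bilateral_term(1)[OF z(2), of 0]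
    by (intro infsum_add summable_on_cmult_right
        summable_on_reindex_bij_betw[OF bij_int_pred, THEN iffD2]) auto
  also have "(\<Sum>\<^sub>\<infinity>k. bilateral_term 0 (k - 1) (q * z)) = (\<Sum>\<^sub>\<infinity>k. bilateral_term 0 k (q * z))"
    by (rule infsum_reindex_bij_betw[OF bij_int_pred])
  finally show ?thesis
    by (simp add: eq infsum_uminus s infsum_cmult_right' eq_neg_iff_add_eq_0 add.commute)
qed

lemma q_translate_in_annulus:
  assumes "1 < norm z" "norm z < 1 / norm q"
  shows "z \<in> annulus" "q * z \<in> annulus" "z \<noteq> 1" "q * z \<noteq> 1" "z \<noteq> 0"
proof -
  have 1: "norm (q * z) < 1" "norm q < norm (q * z)"
    using assms q0 by (auto simp: norm_mult field_simps)
  have 2: "1 < 1 / norm q"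
    using q0 q1 by simp
  show "z \<in> annulus" "q * z \<in> annulus"
    using assms q1 1 2 unfolding annulus_def by auto
  show "z \<noteq> 1" "q * z \<noteq> 1" "z \<noteq> 0"
    using assms 1 by auto
qed

text \<open>Under \<open>z -> q z\<close> the theta product gains \<open>- 1 / z\<close> and the sum
  gains \<open>- z\<close>, so their product is periodic. The zero of the one cancels the pole of
  the other at 1, and the constant is \<open>(q; q)^2\<close>, the value there.\<close>

lemma bilateral_term_0_sum_eq:
  assumes "z \<in> annulus" "z \<noteq> 1"
  shows "1 / (1 - z) + tail 0 z = 1 / ((1 - z) * theta_prod ((1 - z)\<^sup>2 / z))"
proof -
  \<comment> \<open>\<open>f\<close> shows the periodicity, \<open>g\<close> the holomorphy at 1.
    They agree on the punctured annulus.\<close>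
  define f where "f z = qtheta z q * (\<Sum>\<^sub>\<infinity>k. bilateral_term 0 k z)" for z
  define g where "g z = qpoch_inf (q * z) q * qpoch_inf (q / z) q * (1 + (1 - z) * tail 0 z)" for z
  have fg: "f z = g z" if "z \<in> annulus" "z \<noteq> 1" for z
    using that by (simp add: f_def g_def infsum_bilateral_term(2) qtheta_split field_simps)
  have "g holomorphic_on annulus"
    unfolding g_def
    by (intro holomorphic_intros tail_M_test(1)
        holomorphic_on_compose_gen[OF _ qpoch_inf_holomorphic, of _ _ UNIV, unfolded o_def])
      (auto simp: annulus_nonzero)
  then have "isCont g 1"
    using open_annulus one_in_annulus continuous_on_eq_continuous_at holomorphic_on_imp_continuous_on
    by blast
  then have lim: "(g \<longlongrightarrow> g 1) (at 1)"
    by (simp add: isCont_def)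
  have "f z = g 1"
  proof (rule q_periodic_const[where f = f])
    show "f holomorphic_on annulus - {1}"
      by (rule holomorphic_transform[OF holomorphic_on_subset[OF \<open>g holomorphic_on annulus\<close>]])
        (auto simp: fg)
    have "\<forall>\<^sub>F z in at 1. z \<in> annulus \<and> z \<noteq> 1"
      using eventually_at_in_open[OF open_annulus one_in_annulus] by simp
    then show "(f \<longlongrightarrow> g 1) (at 1)"
      by (intro Lim_transform_eventually[OF lim]) (auto elim!: eventually_mono simp: fg)
    show "f (q * z) = f z" if "1 < norm z" "norm z < 1 / norm q" for z
      using sum_bilateral_term_0_shift[OF q_translate_in_annulus(1-3)[OF that]]
        qtheta_shift[OF q_translate_in_annulus(5,3)[OF that]]
      by (simp add: f_def)
  qed (use assms in auto)
  then have "(qpoch_inf q q)\<^sup>2 * (theta_prod ((1 - z)\<^sup>2 / z) * (1 + (1 - z) * tail 0 z)) =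
      (qpoch_inf q q)\<^sup>2 * 1"
    using fg[OF assms] qpoch_prod_eq_theta_prod[OF annulus_nonzero[OF assms(1)]]
    by (simp add: g_def power2_eq_square)
  then have "theta_prod ((1 - z)\<^sup>2 / z) * (1 + (1 - z) * tail 0 z) = 1"
    using qpoch_inf_q_nonzero by simp
  then show ?thesis
    using assms theta_prod_nonzero[OF assms(1)] by (simp add: field_simps)
qed

subsection \<open>The elliptic function and its constant value\<close>

text \<open>For \<open>e = 1\<close> the shift acts on single terms: lowering the index restores the
  denominator, and the remaining factor does not depend on \<open>k\<close>.\<close>

lemma sum_bilateral_term_1_shift:
  assumes "b \<noteq> 0"
  shows "(\<Sum>\<^sub>\<infinity>k. bilateral_term 1 k (q * b)) = - (1 / (q * b)) * (\<Sum>\<^sub>\<infinity>k. bilateral_term 1 k b)"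
proof -
  have eq: "bilateral_term 1 (k - 1) (q * b) = - (1 / (q * b)) * bilateral_term 1 k b" for k
  proof -
    define X where "X = q powi ((k - 1) * k div 2)"
    have p: "q * b * q powi (k - 1) = b * q powi k" "(k - 1) * (k - 1 + 1) = (k - 1) * k"
      "int 1 * k = k" for k
      using q0 by (simp_all add: power_int_diff)
    have 1: "bilateral_term 1 (k - 1) (q * b) =
        (- 1) powi (k - 1) * (q * b) powi (k - 1) * X / (1 - b * q powi k)"
      unfolding bilateral_term_def X_def p ..
    have 2: "bilateral_term 1 k b = (- 1) powi k * b powi k * (X * q powi k) / (1 - b * q powi k)"
      by (simp only: bilateral_term_def q_powi_tri_pred X_def p)
    have 3: "(- 1 :: complex) powi (k - 1) = - ((- 1) powi k)"
      by (simp add: power_int_diff)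
    have 4: "(q * b) powi (k - 1) = (q powi k * b powi k) / (q * b)"
      using q0 assms by (simp add: power_int_diff power_int_mult_distrib)
    show ?thesis
      unfolding 1 2 3 4 by (simp add: mult_ac)
  qed
  have "(\<Sum>\<^sub>\<infinity>k. bilateral_term 1 k (q * b)) = (\<Sum>\<^sub>\<infinity>k. bilateral_term 1 (k - 1) (q * b))"
    by (rule infsum_reindex_bij_betw[OF bij_int_pred, symmetric])
  then show ?thesis
    by (simp only: eq infsum_cmult_right')
qed

definition appell_quotient :: "complex \<Rightarrow> complex" where
  "appell_quotient b = (qpoch_inf q q)\<^sup>2 / qtheta (1 / b) q * (\<Sum>\<^sub>\<infinity>k. bilateral_term 1 k b)"

text \<open>The Appell sum and the theta product in the denominator gain the same factor
  \<open>- 1 / (q * b)\<close>.\<close>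

lemma appell_quotient_shift:
  assumes "b \<noteq> 0" "q * b \<noteq> 1"
  shows "appell_quotient (q * b) = appell_quotient b"
proof -
  have "qtheta (1 / (q * b)) q = - (1 / (q * b)) * qtheta (1 / b) q"
    using qtheta_shift[of "1 / (q * b)"] assms q0 by simp
  then show ?thesis
    using assms q0 sum_bilateral_term_1_shift[OF assms(1)] by (simp add: appell_quotient_def)
qed

definition double_pole_sum :: "complex \<Rightarrow> complex" where
  "double_pole_sum b = (\<Sum>n. double_pole b n + double_pole (q / b) n)"

lemma double_pole_sum_eq: "double_pole_sum b = suminf (double_pole b) + suminf (double_pole (q / b))"
  unfolding double_pole_sum_def by (rule suminf_add[symmetric]; rule summable_double_pole)

lemma suminf_double_pole_split: "suminf (double_pole y) = y / (1 - y)\<^sup>2 + suminf (double_pole (q * y))"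
proof -
  have "double_pole (q * y) = (\<lambda>n. double_pole y (Suc n))"
    by (simp add: double_pole_def fun_eq_iff mult_ac)
  then show ?thesis
    using suminf_split_head[OF summable_double_pole[of y]] by (simp add: double_pole_def[of y 0])
qed

text \<open>The shift removes the head \<open>b / (1 - b)^2\<close> from the first series and adds
  the head at \<open>1 / b\<close> to the second. The two heads are equal.\<close>

lemma double_pole_sum_shift:
  assumes "b \<noteq> 0"
  shows "double_pole_sum (q * b) = double_pole_sum b"
proof -
  have "(1 / b) / (1 - 1 / b)\<^sup>2 = b / (1 - b)\<^sup>2"
  \<comment> \<open>At \<open>b = 1\<close> both quotients have denominator 0 and hence value
    0.\<close>
  proof (cases "b = 1")
    case False
    have "1 - 1 / b = (b - 1) / b"
      using assms by (simp add: field_simps)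
    then show ?thesis
      using assms by (simp add: power_divide power2_eq_square) (simp add: algebra_simps)
  qed simp
  then show ?thesis
    using suminf_double_pole_split[of "1 / b"] suminf_double_pole_split[of b] assms q0
    by (simp add: double_pole_sum_eq)
qed

definition double_pole_sum_reg :: "complex \<Rightarrow> complex" where
  "double_pole_sum_reg z = (\<Sum>n. double_pole (q * z) n + double_pole (q / z) n)"

lemma double_pole_sum_eq_double_pole_sum_reg: "double_pole_sum z = z / (1 - z)\<^sup>2 + double_pole_sum_reg z"
proof -
  have "double_pole_sum_reg z = suminf (double_pole (q * z)) + suminf (double_pole (q / z))"
    unfolding double_pole_sum_reg_def by (rule suminf_add[symmetric]; rule summable_double_pole)
  then show ?thesis
    using suminf_double_pole_split[of z] by (simp add: double_pole_sum_eq)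
qed

text \<open>This value cancels the limit \<open>- 2 * suminf theta_coeff\<close> of the difference
  quotient in \<open>regular_form\<close>.\<close>

lemma double_pole_sum_reg_1: "double_pole_sum_reg 1 = 2 * suminf theta_coeff"
  using suminf_add[OF summable_double_pole[of q] summable_double_pole[of q]]
  by (simp add: double_pole_sum_reg_def theta_coeff_eq_double_pole)

lemma double_pole_sum_reg_holomorphic: "double_pole_sum_reg holomorphic_on annulus"
  unfolding double_pole_sum_reg_def
proof (rule holomorphic_series_M_test(1)[OF open_annulus])
  fix n
  have "q * z * q ^ n \<noteq> 1" "q / z * q ^ n \<noteq> 1" if "z \<in> annulus" for z
    using annulus_mult_power_neq_1[OF that, of n]
      annulus_mult_power_neq_1[OF inverse_in_annulus[OF that], of n] by (simp_all add: mult_ac)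
  then show "(\<lambda>z. double_pole (q * z) n + double_pole (q / z) n) holomorphic_on annulus"
    unfolding double_pole_def by (intro holomorphic_intros) (auto simp: annulus_nonzero)
next
  show "summable (\<lambda>n. 8 * norm q ^ n)"
    by (rule summable_norm_q)
  have "\<forall>\<^sub>F n in sequentially. norm q ^ n < 1 / 2"
    by (rule order_tendstoD(2)[OF LIMSEQ_power_zero]) (use q1 in auto)
  then show "\<forall>\<^sub>F n in sequentially. \<forall>z\<in>annulus.
      norm (double_pole (q * z) n + double_pole (q / z) n) \<le> 8 * norm q ^ n"
  proof eventually_elim
    case (elim n)
    show ?case
    proof
      fix z assume z: "z \<in> annulus"
      have *: "norm (double_pole (q * y) n) \<le> 4 * norm q ^ n" if "y \<in> annulus" for y
      proof -
        have "norm (q * y * q ^ n) < norm q ^ n"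
          using norm_annulus_mult_power[OF that, of n] by (simp add: mult_ac)
        then show ?thesis
          using norm_double_pole_le[of "q * y" n] elim by linarith
      qed
      show "norm (double_pole (q * z) n + double_pole (q / z) n) \<le> 8 * norm q ^ n"
        using norm_triangle_ineq[of "double_pole (q * z) n" "double_pole (q / z) n"]
          *[OF z] *[OF inverse_in_annulus[OF z]] by simp
    qed
  qed
qed

section \<open>Removing the singularity at 1 and computing the value there\<close>

definition const_term :: complex where
  "const_term = (\<Sum>\<^sub>\<infinity>k\<in>UNIV - {0}. of_int k * bilateral_term 0 k 1)"

text \<open>The double poles at 1 have cancelled here: with \<open>w = (1 - z)\<^sup>2 / z\<close>, the first summand is a
  difference quotient of \<open>1 - 1 / (theta_prod w)\<^sup>2\<close> at \<open>w = 0\<close>.\<close>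
definition regular_form :: "complex \<Rightarrow> complex" where
  "regular_form z = (let w = (1 - z)\<^sup>2 / z in
     (1 - 1 / (theta_prod w)\<^sup>2) / w + double_pole_sum_reg z +
     z * ((tail 1 z - tail 0 z) / (z - 1)) / theta_prod w)"

text \<open>With the Appell sum written as \<open>1 / ((1 - z) * H) + C\<close>, the quotient
  contributes the double pole \<open>- 1 / (H^2 * w)\<close>. The head \<open>z / (1 - z)^2\<close>
  of the other series is exactly \<open>1 / w\<close>.\<close>

lemma appell_quotient_plus_double_pole_sum:
  assumes z: "z \<in> annulus" "z \<noteq> 1"
  shows "appell_quotient z + double_pole_sum z = regular_form z"
proof -
  define w where "w = (1 - z)\<^sup>2 / z"
  define H where "H = theta_prod w"
  define C where "C = tail 1 z - tail 0 z"
  have z0: "z \<noteq> 0" "1 - z \<noteq> 0"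
    using z annulus_nonzero by auto
  have H: "H \<noteq> 0"
    unfolding H_def w_def by (rule theta_prod_nonzero[OF z(1)])
  have "qtheta (1 / z) q = (1 - 1 / z) * ((qpoch_inf q q)\<^sup>2 * H)"
    using qtheta_split[of "1 / z"] qpoch_prod_eq_theta_prod[OF z0(1)]
    by (simp add: H_def w_def mult_ac)
  moreover have "(\<Sum>\<^sub>\<infinity>k. bilateral_term 1 k z) = 1 / ((1 - z) * H) + C"
  proof -
    have "1 / (1 - z) + tail 0 z = 1 / ((1 - z) * H)"
      using bilateral_term_0_sum_eq[OF z] by (simp only: H_def w_def)
    then show ?thesis
      using infsum_bilateral_term(2)[OF z(1), of 1] by (simp add: C_def flip: \<open>1 / (1 - z) + tail 0 z = _\<close>)
  qed
  ultimately have "appell_quotient z = 1 / ((1 - 1 / z) * H) * (1 / ((1 - z) * H) + C)"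
    using qpoch_inf_q_nonzero by (simp add: appell_quotient_def)
  also have "1 - 1 / z = - (1 - z) / z"
    using z0 by (simp add: field_simps)
  also have "1 / (- (1 - z) / z * H) * (1 / ((1 - z) * H) + C) =
      - (1 / H\<^sup>2) / w + z * (C / (z - 1)) / H"
  proof -
    have "1 / (- x / z * H) * (1 / (x * H) + C) = - (1 / H\<^sup>2) / (x\<^sup>2 / z) + z * (C / (- x)) / H"
      if "x \<noteq> 0" for x
      using that z0 H by (simp add: divide_simps power2_eq_square) (simp add: algebra_simps)
    from this[OF z0(2)] show ?thesis
      by (simp add: w_def)
  qed
  finally have "appell_quotient z + double_pole_sum z =
      - (1 / H\<^sup>2) / w + z * (C / (z - 1)) / H + (1 / w + double_pole_sum_reg z)"
    by (simp add: double_pole_sum_eq_double_pole_sum_reg w_def)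
  also have "\<dots> = regular_form z"
    unfolding regular_form_def Let_def w_def[symmetric] H_def[symmetric] C_def[symmetric]
    by (simp add: diff_divide_distrib)
  finally show ?thesis .
qed

lemma regular_form_holomorphic: "regular_form holomorphic_on annulus - {1}"
proof -
  have "(\<lambda>z. theta_prod ((1 - z)\<^sup>2 / z)) holomorphic_on annulus - {1}"
    by (rule holomorphic_on_compose_gen[OF _ theta_prod_holomorphic, of _ _ UNIV, unfolded o_def])
      (auto intro!: holomorphic_intros dest: annulus_nonzero)
  moreover have "tail e holomorphic_on annulus - {1}" if "e \<le> 1" for e
    using holomorphic_on_subset[OF tail_M_test(1)[OF that]] by blast
  moreover have "double_pole_sum_reg holomorphic_on annulus - {1}"
    using holomorphic_on_subset[OF double_pole_sum_reg_holomorphic] by blast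
  ultimately show ?thesis
    unfolding regular_form_def Let_def
    by (intro holomorphic_intros) (auto simp: theta_prod_nonzero dest: annulus_nonzero)
qed

lemma regular_form_tendsto: "(regular_form \<longlongrightarrow> const_term) (at 1)"
proof -
  define w where "w z = (1 - z)\<^sup>2 / z" for z :: complex
  have "isCont w 1" "w 1 = 0"
    unfolding w_def by (auto intro!: continuous_intros)
  then have w0: "(w \<longlongrightarrow> 0) (at 1)"
    by (metis isCont_def)
  have ann: "\<forall>\<^sub>F z in at 1. z \<in> annulus \<and> z \<noteq> 1"
    using eventually_at_in_open[OF open_annulus one_in_annulus] by simp
  \<comment> \<open>Composition with a difference quotient at 0 requires \<open>w\<close> to avoid 0
    near 1, not only to tend to 0.\<close>
  then have wlim: "filterlim w (at 0) (at 1)"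
    unfolding filterlim_at using w0
    by (auto elim!: eventually_mono simp: w_def dest: annulus_nonzero)
  have "isCont theta_prod 0"
    using theta_prod_has_derivative_0 by (rule DERIV_isCont)
  then have H: "((\<lambda>z. theta_prod (w z)) \<longlongrightarrow> 1) (at 1)"
    using isCont_tendsto_compose[OF _ w0] theta_prod_0 by force
  \<comment> \<open>The derivative is \<open>2 * H' / H^3\<close>, with \<open>H = 1\<close> and
    \<open>H' = - suminf theta_coeff\<close> at 0.\<close>
  have "((\<lambda>w. 1 - 1 / (theta_prod w)\<^sup>2) has_field_derivative - 2 * suminf theta_coeff) (at 0)"
    by (auto intro!: derivative_eq_intros theta_prod_has_derivative_0 simp: theta_prod_0)
  then have "((\<lambda>w. (1 - 1 / (theta_prod w)\<^sup>2) / w) \<longlongrightarrow> - 2 * suminf theta_coeff) (at 0)"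
    by (simp add: has_field_derivative_iff theta_prod_0)
  then have P: "((\<lambda>z. (1 - 1 / (theta_prod (w z))\<^sup>2) / w z) \<longlongrightarrow> - 2 * suminf theta_coeff) (at 1)"
    by (rule filterlim_compose[OF _ wlim])
  \<comment> \<open>Because the tails agree at 1, this is the difference quotient of their
    difference.\<close>
  have C: "((\<lambda>z. (tail 1 z - tail 0 z) / (z - 1)) \<longlongrightarrow> const_term) (at 1)"
    using tail_diff_has_derivative
    unfolding has_field_derivative_iff const_term_def tail_1_1 diff_self diff_zero .
  have "isCont double_pole_sum_reg 1"
    using double_pole_sum_reg_holomorphic open_annulus one_in_annulus continuous_on_eq_continuous_at
      holomorphic_on_imp_continuous_on by blast
  then have R: "(double_pole_sum_reg \<longlongrightarrow> 2 * suminf theta_coeff) (at 1)"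
    by (simp add: isCont_def double_pole_sum_reg_1)
  have "((\<lambda>z. (1 - 1 / (theta_prod (w z))\<^sup>2) / w z + double_pole_sum_reg z +
      z * ((tail 1 z - tail 0 z) / (z - 1)) / theta_prod (w z)) \<longlongrightarrow>
      - 2 * suminf theta_coeff + 2 * suminf theta_coeff + 1 * const_term / 1) (at 1)"
    by (intro tendsto_intros P R C H) auto
  then show ?thesis
    by (simp add: regular_form_def[abs_def] Let_def w_def)
qed

text \<open>\<open>regular_form\<close> inherits periodicity from the two functions whose sum it is
  on the punctured annulus, and its limit at 1 fixes the constant.\<close>

lemma appell_quotient_plus_double_pole_sum_annulus:
  assumes "z \<in> annulus" "z \<noteq> 1"
  shows "appell_quotient z + double_pole_sum z = const_term"
proof -
  have "regular_form z = const_term"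
  proof (rule q_periodic_const[OF regular_form_holomorphic _ regular_form_tendsto assms])
    show "regular_form (q * z) = regular_form z" if "1 < norm z" "norm z < 1 / norm q" for z
      using appell_quotient_shift[OF q_translate_in_annulus(5,4)[OF that]]
        double_pole_sum_shift[OF q_translate_in_annulus(5)[OF that]]
        appell_quotient_plus_double_pole_sum q_translate_in_annulus[OF that] by metis
  qed
  then show ?thesis
    using appell_quotient_plus_double_pole_sum[OF assms] by simp
qed

section \<open>From the annulus to every admissible \<open>b\<close>\<close>

lemma appell_quotient_plus_double_pole_sum_power_shift:
  assumes "b \<noteq> 0" "\<And>k :: int. b * q powi k \<noteq> 1"
  shows "appell_quotient (b * q ^ n) + double_pole_sum (b * q ^ n) = appell_quotient b + double_pole_sum b"
proof (induction n)
  case (Suc n)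
  have "b * q ^ n \<noteq> 0" "q * (b * q ^ n) \<noteq> 1"
    using assms(1) assms(2)[of "int (Suc n)"] q0 by (simp_all add: power_int_add mult_ac)
  then show ?case
    using Suc appell_quotient_shift[of "b * q ^ n"] double_pole_sum_shift[of "b * q ^ n"] by (simp add: mult_ac)
qed simp

lemma exists_powi_in_annulus:
  assumes "b \<noteq> 0"
  obtains k :: int where "b * q powi k \<in> annulus"
proof -
  define L where "L = - ln (norm q)"
  have L: "0 < L"
    using q0 q1 by (simp add: L_def)
  \<comment> \<open>This \<open>k\<close> puts \<open>ln (norm b) - k * L\<close> into the interval
    from \<open>- L\<close> (excluded) to 0 (included), so
    \<open>|q| < |b q^k| <= 1\<close>.\<close>
  define k where "k = \<lceil>ln (norm b) / L\<rceil>"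
  have "ln (norm b) / L \<le> of_int k" "of_int k < ln (norm b) / L + 1"
    unfolding k_def by linarith+
  then have "ln (norm b) \<le> of_int k * L" "of_int k * L < ln (norm b) + L"
    using L by (simp_all add: field_simps)
  moreover have "norm (b * q powi k) = exp (ln (norm b) - of_int k * L)"
    using assms q0 by (simp add: norm_mult norm_power_int exp_diff L_def exp_minus
        flip: powr_real_of_int' ) (simp add: powr_def exp_add)
  moreover have "norm q = exp (- L)"
    using q0 by (simp add: L_def)
  moreover have "1 < 1 / norm q"
    using q0 q1 by simp
  ultimately have "norm q < norm (b * q powi k)" "norm (b * q powi k) \<le> 1"
    by auto
  with \<open>1 < 1 / norm q\<close> have "b * q powi k \<in> annulus"
    by (simp add: annulus_def)
  then show ?thesis
    by (rule that)
qed

lemma appell_quotient_plus_double_pole_sum_eq_const_term: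
  assumes b: "b \<noteq> 0" "\<And>k :: int. b * q powi k \<noteq> 1"
  shows "appell_quotient b + double_pole_sum b = const_term"
proof -
  obtain k where k: "b * q powi k \<in> annulus"
    using exists_powi_in_annulus[OF b(1)] by blast
  define c where "c = b * q powi k"
  have c: "c \<noteq> 0" "c * q powi j \<noteq> 1" for j
    using b(1) b(2)[of "k + j"] q0 by (auto simp: c_def power_int_add mult.assoc)
  have "c \<noteq> 1"
    using c(2)[of 0] by simp
  then have "appell_quotient c + double_pole_sum c = const_term"
    using appell_quotient_plus_double_pole_sum_annulus k by (simp add: c_def)
  moreover have "appell_quotient c + double_pole_sum c = appell_quotient b + double_pole_sum b"
  proof (cases k rule: int_cases2)
    case (nonneg n)
    then show ?thesis
      using appell_quotient_plus_double_pole_sum_power_shift[OF b, of n] by (simp add: c_def)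
  next
    \<comment> \<open>Positive powers only move in one direction, so here the shift starts at
      \<open>c\<close> and arrives at \<open>b\<close>.\<close>
    case (nonpos n)
    then have "c * q ^ n = b"
      using q0 by (simp add: c_def power_int_minus)
    then show ?thesis
      using appell_quotient_plus_double_pole_sum_power_shift[OF c, of n] by simp
  qed
  ultimately show ?thesis
    by simp
qed

end

theorem theorem7:
  fixes q b :: complex
  assumes "0 < norm q" and "norm q < 1"
    and "b \<noteq> 0" and "b \<notin> {q powi k | k :: int. True}"
  shows "(qpoch_inf q q)\<^sup>2 / qtheta (1 / b) q *
           (\<Sum>\<^sub>\<infinity>k\<in>(UNIV :: int set). (- b) powi k * q powi (k * (k + 1) div 2) / (1 - b * q powi k))
       = - (\<Sum>n. q ^ n * b / (1 - b * q ^ n)\<^sup>2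
                + (q ^ (n + 1) / b) / (1 - q ^ (n + 1) / b)\<^sup>2)
         + (\<Sum>\<^sub>\<infinity>n\<in>(UNIV - {0} :: int set).
              (- 1) powi n * of_int n * q powi (n * (n + 1) div 2) / (1 - q powi n))"
proof -
  interpret nome q
    using assms by unfold_locales
  have "b * q powi k \<noteq> 1" for k
  proof
    assume "b * q powi k = 1"
    then have "b = q powi (- k)"
      using assms(1) by (simp add: power_int_minus field_simps)
    then show False
      using assms(4) by blast
  qed
  then have "appell_quotient b + double_pole_sum b = const_term"
    using appell_quotient_plus_double_pole_sum_eq_const_term assms(3) by blast
  moreover have "(- b) powi k * q powi (k * (k + 1) div 2) / (1 - b * q powi k) = bilateral_term 1 k b" for k
    using power_int_mult_distrib[of "- 1" b k] by (simp add: bilateral_term_def)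
  moreover have "double_pole_sum b = (\<Sum>n. q ^ n * b / (1 - b * q ^ n)\<^sup>2
      + (q ^ (n + 1) / b) / (1 - q ^ (n + 1) / b)\<^sup>2)"
    by (simp add: double_pole_sum_def double_pole_def mult.commute)
  moreover have "const_term = (\<Sum>\<^sub>\<infinity>n\<in>UNIV - {0}.
      (- 1) powi n * of_int n * q powi (n * (n + 1) div 2) / (1 - q powi n))"
    by (simp add: const_term_def bilateral_term_def mult_ac)
  ultimately show ?thesis
    by (simp add: appell_quotient_def eq_diff_eq)
qed

end
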